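(* Let $a,b$ be positive integers. Then the number of lozenge tilings of the region $H_{\mathrm o}(a,b,a)$ is $$L(H_{\mathrm o}(a,b,a))=(b+1)^a.$$
   Context: Triangular lattice: let $e=(1,0)$, $f=(1/2,\sqrt3/2)$, $g=f-e=(-1/2,\sqrt3/2)$, and consider the lattice $\mathbb Z e+\mathbb Z f$ with its tiling of the plane by unit equilateral triangles. A lozenge is the union of two unit triangles sharing an edge. A lozenge tiling of a region $R$ (a finite union of unit triangles) is a decomposition of $R$ into lozenges with disjoint interiors; $L(R)$ is the number of lozenge tilings of $R$. $H(a,b,c)$ ($a,b,c$ positive integers) is the hexagon with vertices, in counterclockwise order, $0$ (southwestern corner), $be$ (southeastern corner), $be+af$ (eastern corner), $be+af+cg$ (northeastern corner), $af+cg$ (northwestern corner), $cg$ (western corner). Thus its horizontal sides have length $b$, the southeastern and northwestern sides have length $a$, and the northeastern and southwestern sides have length $c$. Maximal staircase at a corner $V$: let $p,q$ be the lengths of the two sides meeting at $V$, let $s,t$ be the unit vectors pointing from $V$ along these two sides (they form an angle of $120^\circ$), and let $m=\min(p,q)$. For $i,j\ge1$ let the cell $(i,j)$ be the lozenge with vertices $V+(i-1)s+(j-1)t$, $V+is+(j-1)t$, $V+is+jt$, $V+(i-1)s+jt$. The maximal staircase at $V$ is the union of all cells $(i,j)$ with $i,j\ge1$ and $i+j\le m$ (so it has rows of $m-1,m-2,\dots,1$ lozenges). $H_{\mathrm o}(a,b,c)$ is the region obtained from $H(a,b,c)$ by removing the maximal staircases at the western and at the eastern corner (at each of these, sides of lengths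 $a$ and $c$ meet). *)

theory Defs
  imports "HOL-Analysis.Analysis"
begin

type_synonym plane = "real \<times> real"

definition vec_e :: plane where "vec_e = (1, 0)"

definition vec_f :: plane where "vec_f = (1/2, sqrt 3 / 2)"

definition vec_g :: plane where "vec_g = vec_f - vec_e"

definition tri_lattice :: "plane set" where
  "tri_lattice = {of_int x *\<^sub>R vec_e + of_int y *\<^sub>R vec_f | x y :: int. True}"

definition unit_edges :: "plane set set" where
  "unit_edges = {closed_segment v (v + d) | v d. v \<in> tri_lattice \<and> d \<in> {vec_e, vec_f, vec_g}}"

definition unit_triangles :: "plane set set" where
  "unit_triangles =
     {convex hull {v, v + vec_e, v + vec_f} | v. v \<in> tri_lattice} \<union>
     {convex hull {v, v + vec_f, v + vec_g} | v. v \<in> tri_lattice}"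

definition lozenge :: "plane set \<Rightarrow> bool" where
  "lozenge D \<longleftrightarrow>
     (\<exists>S\<in>unit_triangles. \<exists>T\<in>unit_triangles. S \<inter> T \<in> unit_edges \<and> D = S \<union> T)"

definition lozenge_tiling :: "plane set \<Rightarrow> plane set set \<Rightarrow> bool" where
  "lozenge_tiling R \<D> \<longleftrightarrow>
     (\<forall>D\<in>\<D>. lozenge D) \<and>
     pairwise (\<lambda>D D'. interior D \<inter> interior D' = {}) \<D> \<and>
     \<Union>\<D> = R"

definition num_lozenge_tilings :: "plane set \<Rightarrow> nat" where
  "num_lozenge_tilings R = card {\<D>. lozenge_tiling R \<D>}"

definition hexagon :: "nat \<Rightarrow> nat \<Rightarrow> nat \<Rightarrow> plane set" where
  "hexagon a b c = convex hull
     {0,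
      real b *\<^sub>R vec_e,
      real b *\<^sub>R vec_e + real a *\<^sub>R vec_f,
      real b *\<^sub>R vec_e + real a *\<^sub>R vec_f + real c *\<^sub>R vec_g,
      real a *\<^sub>R vec_f + real c *\<^sub>R vec_g,
      real c *\<^sub>R vec_g}"

definition cell :: "plane \<Rightarrow> plane \<Rightarrow> plane \<Rightarrow> nat \<Rightarrow> nat \<Rightarrow> plane set" where
  "cell V s t i j = convex hull
     {V + (real i - 1) *\<^sub>R s + (real j - 1) *\<^sub>R t,
      V + real i *\<^sub>R s + (real j - 1) *\<^sub>R t,
      V + real i *\<^sub>R s + real j *\<^sub>R t,
      V + (real i - 1) *\<^sub>R s + real j *\<^sub>R t}"

text \<open>The maximal staircase at the corner \<open>V\<close> where sides of lengths \<open>p\<close> and \<open>q\<close> meet,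
  these sides leaving \<open>V\<close> in the directions of the unit vectors \<open>s\<close> and \<open>t\<close>, respectively.\<close>

definition max_staircase :: "plane \<Rightarrow> nat \<Rightarrow> nat \<Rightarrow> plane \<Rightarrow> plane \<Rightarrow> plane set" where
  "max_staircase V p q s t =
     \<Union>{cell V s t i j | i j. 1 \<le> i \<and> 1 \<le> j \<and> i + j \<le> min p q}"

text \<open>At the western corner the southwestern side (length \<open>c\<close>) runs in direction \<open>- g\<close> and the
  northwestern side (length \<open>a\<close>) in direction \<open>f\<close>.\<close>

definition west_staircase :: "nat \<Rightarrow> nat \<Rightarrow> nat \<Rightarrow> plane set" where
  "west_staircase a b c = max_staircase (real c *\<^sub>R vec_g) c a (- vec_g) vec_f"

text \<open>At the eastern corner the southeastern side (length \<open>a\<close>) runs in direction \<open>- f\<close> and the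
  northeastern side (length \<open>c\<close>) in direction \<open>g\<close>.\<close>

definition east_staircase :: "nat \<Rightarrow> nat \<Rightarrow> nat \<Rightarrow> plane set" where
  "east_staircase a b c =
     max_staircase (real b *\<^sub>R vec_e + real a *\<^sub>R vec_f) a c (- vec_f) vec_g"

text \<open>Regions are unions of closed unit triangles, so a removed subregion leaves its common
  boundary with the rest in place; hence the closure of the set difference.\<close>

definition hexagon_o :: "nat \<Rightarrow> nat \<Rightarrow> nat \<Rightarrow> plane set" where
  "hexagon_o a b c = closure (hexagon a b c - (west_staircase a b c \<union> east_staircase a b c))"

end

theory Submission
  imports Defs
begin

text \<open>Cut the plane along the horizontal lattice lines. In the full hexagon with sides \<open>b, a, a, b, a,
a\<close>, exactly \<open>min k (2a - k)\<close> lozenges of any tiling cross the line at height \<open>k\<close>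
(measured in triangle heights). The two staircases contain, in total, \<open>2 \<lfloor>min k (2a - k) /
2\<rfloor>\<close> lozenges crossing that line. A tiling of the remaining region becomes a tiling of the hexagon by
adding the cells of the staircases, so in it no lozenge crosses a line of even height and exactly one crosses each
line of odd height up to \<open>2a\<close>. What is left is a vertical stack of \<open>a\<close> hexagons with
sides \<open>b, 1, 1, b, 1, 1\<close>, consecutive ones sharing a horizontal side. Such a small hexagon has
\<open>b + 1\<close> tilings, one for each position of the lozenge crossing its middle line, and by the above no
lozenge straddles two of them; hence the count \<open>(b + 1) ^ a\<close>.

The formal argument separates geometry from combinatorics. Every point is written as \<open>x e + y f\<close>, so
that lattice triangles, lozenges and the hexagon become sets cut out by bounds on \<open>x\<close>,
\<open>y\<close> and \<open>x + y\<close>. A point in the open part of a triangle lies in no other triangle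
(\<open>tri_unique\<close>), and each triangle is the closure of its open part; therefore a region determines its
set of triangles, and interiors of regions are disjoint exactly if the regions have no triangle in common. Lozenge
tilings thereby become perfect matchings between upward and downward triangles
(\<open>num_lozenge_tilings_region\<close>). The same two facts evaluate the closure in the definition of the
region and identify its triangles (\<open>hexagon_o_eq\<close>): they are the triangles of height between
\<open>0\<close> and \<open>2a\<close> whose centre has Cartesian abscissa between \<open>0\<close> and
\<open>b\<close>, and these form the stack of small hexagons.

In the resulting matching problem, rows \<open>2 m\<close> and \<open>2 m + 1\<close> of triangles form the small
hexagon number \<open>m\<close>. By induction on \<open>m\<close> the upward triangles of row \<open>2 m\<close>
have no partner below, and then the matching within the hexagon is forced by one threshold \<open>K\<close> between
\<open>0\<close> and \<open>b\<close> (\<open>matching_row\<close>). So matchings correspond to arbitrary choices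
of one threshold per hexagon (\<open>card_matchings\<close>).\<close>

section \<open>Lattice coordinates\<close>

definition latt :: "real \<Rightarrow> real \<Rightarrow> plane" where
  "latt x y = x *\<^sub>R vec_e + y *\<^sub>R vec_f"

definition cx :: "plane \<Rightarrow> real" where "cx p = fst p - snd p / sqrt 3"
definition cy :: "plane \<Rightarrow> real" where "cy p = 2 * snd p / sqrt 3"

lemma coords_latt [simp]: "cx (latt x y) = x" "cy (latt x y) = y"
  by (simp_all add: latt_def cx_def cy_def vec_e_def vec_f_def)

lemma latt_coords [simp]: "latt (cx p) (cy p) = p"
  by (cases p) (simp add: latt_def cx_def cy_def vec_e_def vec_f_def)

lemma plane_eq_iff: "p = q \<longleftrightarrow> cx p = cx q \<and> cy p = cy q"
  by (metis latt_coords)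

lemma linear_coords: "linear cx" "linear cy"
  by (auto intro!: linearI simp: cx_def cy_def field_simps)

lemma coords_simps [simp]:
  "cx 0 = 0" "cy 0 = 0"
  "cx (p + q) = cx p + cx q" "cy (p + q) = cy p + cy q"
  "cx (p - q) = cx p - cx q" "cy (p - q) = cy p - cy q"
  "cx (- p) = - cx p" "cy (- p) = - cy p"
  "cx (r *\<^sub>R p) = r * cx p" "cy (r *\<^sub>R p) = r * cy p"
  using linear_coords
  by (simp_all add: linear_0 linear_add linear_diff linear_neg linear_scale)

lemma coords_vec [simp]:
  "cx vec_e = 1" "cy vec_e = 0" "cx vec_f = 0" "cy vec_f = 1" "cx vec_g = -1" "cy vec_g = 1"
  by (simp_all add: vec_g_def) (simp_all add: cx_def cy_def vec_e_def vec_f_def)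

lemma continuous_coords [continuous_intros]: "continuous_on S cx" "continuous_on S cy"
  using linear_coords linear_continuous_on linear_linear by blast+

text \<open>Any convex polygon whose sides are parallel to \<open>e\<close>, \<open>f\<close> and \<open>g\<close>:
along these directions \<open>cy\<close>, \<open>cx\<close> and \<open>cx + cy\<close>, respectively, are
constant.\<close>

definition hex_polygon :: "real \<Rightarrow> real \<Rightarrow> real \<Rightarrow> real \<Rightarrow> real \<Rightarrow> real \<Rightarrow> plane set" where
  "hex_polygon l u l' u' l'' u'' =
     {p. cx p \<in> {l..u} \<and> cy p \<in> {l'..u'} \<and> cx p + cy p \<in> {l''..u''}}"

lemma convex_hex_polygon: "convex (hex_polygon l u l' u' l'' u'')"
proof -
  have "linear (\<lambda>p. cx p + cy p)"
    using linear_coords by (rule linear_compose_add)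
  moreover have "hex_polygon l u l' u' l'' u'' =
      cx -` {l..u} \<inter> cy -` {l'..u'} \<inter> (\<lambda>p. cx p + cy p) -` {l''..u''}"
    by (auto simp: hex_polygon_def)
  ultimately show ?thesis
    using linear_coords by (auto intro!: convex_Int convex_linear_vimage)
qed

section \<open>Unit triangles and the regions they form\<close>

text \<open>A triangle is named after the lattice point \<open>(i, j)\<close> that serves as the point
\<open>v\<close> in the definition of the unit triangles: for \<open>Up\<close> it is the left end of the
horizontal side, for \<open>Down\<close> it is the bottom vertex.\<close>

datatype triangle = Up "int \<times> int" | Down "int \<times> int"

fun tri :: "triangle \<Rightarrow> plane set" where
  "tri (Up (i, j)) = {p. i \<le> cx p \<and> j \<le> cy p \<and> cx p + cy p \<le> i + j + 1}"
| "tri (Down (i, j)) = {p. cx p \<le> i \<and> cy p \<le> j + 1 \<and> i + j \<le> cx p + cy p}"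

fun open_tri :: "triangle \<Rightarrow> plane set" where
  "open_tri (Up (i, j)) = {p. i < cx p \<and> j < cy p \<and> cx p + cy p < i + j + 1}"
| "open_tri (Down (i, j)) = {p. cx p < i \<and> cy p < j + 1 \<and> i + j < cx p + cy p}"

lemma tri_Up_hull:
  "tri (Up (i, j)) = convex hull {latt i j, latt i j + vec_e, latt i j + vec_f}" (is "?L = ?R")
proof (intro set_eqI iffI)
  fix p assume p: "p \<in> ?L"
  show "p \<in> ?R"
    unfolding convex_hull_3_alt using p
    by (intro CollectI exI[of _ "cx p - i"] exI[of _ "cy p - j"]) (simp add: plane_eq_iff)
qed (auto simp: convex_hull_3_alt)

lemma tri_Down_hull:
  "tri (Down (i, j)) = convex hull {latt i j, latt i j + vec_f, latt i j + vec_g}" (is "?L = ?R")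
proof (intro set_eqI iffI)
  fix p assume p: "p \<in> ?L"
  show "p \<in> ?R"
    unfolding convex_hull_3_alt using p
    by (intro CollectI exI[of _ "cx p + cy p - i - j"] exI[of _ "i - cx p"]) (simp add: plane_eq_iff)
qed (auto simp: convex_hull_3_alt)

lemma bex_tri_lattice: "(\<exists>v\<in>tri_lattice. P v) \<longleftrightarrow> (\<exists>(x::int) (y::int). P (latt x y))"
  unfolding tri_lattice_def latt_def by blast

lemma unit_triangles_eq: "unit_triangles = range tri"
proof (intro set_eqI)
  fix T :: "plane set"
  have "T \<in> unit_triangles \<longleftrightarrow> (\<exists>v\<in>tri_lattice. T = convex hull {v, v + vec_e, v + vec_f} \<or>
      T = convex hull {v, v + vec_f, v + vec_g})"
    unfolding unit_triangles_def by blast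
  also have "\<dots> \<longleftrightarrow> (\<exists>(x::int) (y::int). T = tri (Up (x, y)) \<or> T = tri (Down (x, y)))"
    by (simp only: bex_tri_lattice tri_Up_hull tri_Down_hull)
  also have "\<dots> \<longleftrightarrow> T \<in> range tri"
  proof -
    have "(\<exists>t. T = tri t) \<longleftrightarrow> (\<exists>v. T = tri (Up v) \<or> T = tri (Down v))"
      by (metis triangle.exhaust)
    then show ?thesis by (simp add: image_iff del: tri.simps)
  qed
  finally show "T \<in> unit_triangles \<longleftrightarrow> T \<in> range tri" .
qed

lemma open_tri_subset: "open_tri t \<subseteq> tri t"
  by (cases t rule: tri.cases) auto

lemma open_open_tri: "open (open_tri t)"
  by (cases t rule: tri.cases)
    (auto intro!: open_Collect_conj open_Collect_less continuous_intros)

lemma closed_tri: "closed (tri t)"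
  by (cases t rule: tri.cases)
    (auto intro!: closed_Collect_conj closed_Collect_le continuous_intros)

text \<open>The open part of a triangle lies strictly between consecutive lattice lines in each of the three
directions. A triangle that reaches such a point must be bounded by the same lines; integrality of its position
turns this into equality.\<close>

lemma tri_unique:
  assumes "p \<in> open_tri s" "p \<in> tri t"
  shows "s = t"
proof (cases s rule: tri.cases)
  case s: (1 i j)
  show ?thesis
  proof (cases t rule: tri.cases)
    case t: (1 k l)
    have "k \<le> i" "l \<le> j" "i + j \<le> k + l"
      using assms unfolding s t by (simp; linarith)+
    then show ?thesis unfolding s t by simp
  next
    case t: (2 k l)
    have "i + 1 \<le> k" "j \<le> l" "k + l \<le> i + j"
      using assms unfolding s t by (simp; linarith)+
    then show ?thesis by simp
  qed
next
  case s: (2 i j)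
  show ?thesis
  proof (cases t rule: tri.cases)
    case t: (1 k l)
    have "k + 1 \<le> i" "l \<le> j" "i + j \<le> k + l"
      using assms unfolding s t by (simp; linarith)+
    then show ?thesis by simp
  next
    case t: (2 k l)
    have "i \<le> k" "j \<le> l" "k + l \<le> i + j"
      using assms unfolding s t by (simp; linarith)+
    then show ?thesis unfolding s t by simp
  qed
qed

fun center :: "triangle \<Rightarrow> plane" where
  "center (Up (i, j)) = latt (i + 1/3) (j + 1/3)"
| "center (Down (i, j)) = latt (i - 1/3) (j + 2/3)"

lemma center_in_open_tri: "center t \<in> open_tri t"
  by (cases t rule: tri.cases) auto

text \<open>Moving a point of the triangle slightly towards the centre makes all three inequalities strict.\<close>

lemma tri_subset_closure: "tri t \<subseteq> closure (open_tri t)"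
proof
  fix p assume p: "p \<in> tri t"
  have *: "0 < (1 - u) * x + u / 3" if "0 < u" "u < 1" "0 \<le> x" for u x :: real
    using that by (intro add_nonneg_pos) auto
  have "open_segment p (center t) \<subseteq> open_tri t"
  proof
    fix q assume "q \<in> open_segment p (center t)"
    then obtain u where u: "0 < u" "u < 1" "q = (1 - u) *\<^sub>R p + u *\<^sub>R center t"
      by (auto simp: in_segment)
    then have q: "cx q = (1 - u) * cx p + u * cx (center t)"
        "cy q = (1 - u) * cy p + u * cy (center t)"
      by simp_all
    show "q \<in> open_tri t"
    proof (cases t rule: tri.cases)
      case (1 i j)
      then show ?thesis
        using p q *[OF u(1,2), of "cx p - i"] *[OF u(1,2), of "cy p - j"]
          *[OF u(1,2), of "i + j + 1 - (cx p + cy p)"]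
        by (auto simp: algebra_simps)
    next
      case (2 i j)
      then show ?thesis
        using p q *[OF u(1,2), of "i - cx p"] *[OF u(1,2), of "j + 1 - cy p"]
          *[OF u(1,2), of "cx p + cy p - (i + j)"]
        by (auto simp: algebra_simps)
    qed
  qed
  then have "closure (open_segment p (center t)) \<subseteq> closure (open_tri t)"
    by (rule closure_mono)
  then show "p \<in> closure (open_tri t)"
    using center_in_open_tri[of t] closure_subset[of "open_tri t"]
    by (cases "p = center t") (auto simp: closure_open_segment)
qed

definition region :: "triangle set \<Rightarrow> plane set" where
  "region T = \<Union>(tri ` T)"

text \<open>The centre of a triangle lies in no other triangle, so it witnesses that the triangle belongs to the
set.\<close>

lemma region_subset_iff: "region S \<subseteq> region T \<longleftrightarrow> S \<subseteq> T"
proof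
  assume *: "region S \<subseteq> region T"
  show "S \<subseteq> T"
  proof
    fix s assume "s \<in> S"
    then have "center s \<in> region T"
      using * center_in_open_tri open_tri_subset by (force simp: region_def)
    then show "s \<in> T"
      using tri_unique[OF center_in_open_tri] by (auto simp: region_def)
  qed
qed (auto simp: region_def)

lemma region_eq_iff: "region S = region T \<longleftrightarrow> S = T"
  using region_subset_iff by (metis subset_antisym order_refl)

lemma open_tri_meets: 
  assumes "open U" "p \<in> U" "p \<in> tri t"
  shows "U \<inter> open_tri t \<noteq> {}"
  using assms tri_subset_closure[of t] open_Int_closure_eq_empty[of U "open_tri t"] by blast

text \<open>An open set meeting a triangle meets the open part of that triangle, whose points lie in no other
triangle.\<close>

lemma interior_region_disjoint_iff:
  "interior (region S) \<inter> interior (region T) = {} \<longleftrightarrow> S \<inter> T = {}"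
proof
  assume *: "interior (region S) \<inter> interior (region T) = {}"
  { fix t assume "t \<in> S" "t \<in> T"
    then have "open_tri t \<subseteq> interior (region S)" "open_tri t \<subseteq> interior (region T)"
      using open_open_tri[of t] open_tri_subset[of t]
      by (metis UN_upper interior_maximal order_trans region_def)+
    then have False
      using * center_in_open_tri[of t] by blast }
  then show "S \<inter> T = {}" by blast
next
  assume *: "S \<inter> T = {}"
  show "interior (region S) \<inter> interior (region T) = {}" (is "?U = {}")
  proof (rule ccontr)
    assume "?U \<noteq> {}"
    then obtain p s where "p \<in> ?U" "p \<in> tri s" "s \<in> S"
      using interior_subset by (force simp: region_def)
    then obtain q where "q \<in> ?U" "q \<in> open_tri s"
      using open_tri_meets[OF open_Int[OF open_interior open_interior]] by blast
    moreover then obtain t where "q \<in> tri t" "t \<in> T"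
      using interior_subset by (force simp: region_def)
    ultimately show False
      using tri_unique \<open>s \<in> S\<close> * by blast
  qed
qed

section \<open>Lozenges\<close>

text \<open>The positions of the three downward triangles across the left, the right and the horizontal side of the
upward triangle at \<open>(x, y)\<close>, in this order.\<close>

fun nbrs :: "int \<times> int \<Rightarrow> (int \<times> int) set" where
  "nbrs (x, y) = {(x, y), (x + 1, y), (x + 1, y - 1)}"

lemma closed_segment_offset:
  fixes v d :: "'a::real_vector"
  shows "p \<in> closed_segment v (v + d) \<longleftrightarrow> (\<exists>u. 0 \<le> u \<and> u \<le> 1 \<and> p = v + u *\<^sub>R d)"
proof -
  have "(1 - u) *\<^sub>R v + u *\<^sub>R (v + d) = v + u *\<^sub>R d" for u
    by (simp add: algebra_simps)
  then show ?thesis by (simp add: in_segment)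
qed

lemma edge_mem:
  "p \<in> closed_segment (latt x y) (latt x y + vec_e) \<longleftrightarrow> cy p = y \<and> x \<le> cx p \<and> cx p \<le> x + 1"
  "p \<in> closed_segment (latt x y) (latt x y + vec_f) \<longleftrightarrow> cx p = x \<and> y \<le> cy p \<and> cy p \<le> y + 1"
  "p \<in> closed_segment (latt x y) (latt x y + vec_g) \<longleftrightarrow>
     cx p + cy p = x + y \<and> y \<le> cy p \<and> cy p \<le> y + 1"
proof -
  have *: "(\<exists>u::real. 0 \<le> u \<and> u \<le> 1 \<and> c = z + u) \<longleftrightarrow> z \<le> c \<and> c \<le> z + 1" for c z
    by (auto intro: exI[of _ "c - z"])
  show "p \<in> closed_segment (latt x y) (latt x y + vec_e) \<longleftrightarrow> cy p = y \<and> x \<le> cx p \<and> cx p \<le> x + 1"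
    using *[of "cx p" x] by (auto simp: closed_segment_offset plane_eq_iff)
  show "p \<in> closed_segment (latt x y) (latt x y + vec_f) \<longleftrightarrow> cx p = x \<and> y \<le> cy p \<and> cy p \<le> y + 1"
    using *[of "cy p" y] by (auto simp: closed_segment_offset plane_eq_iff)
  have "cx p + cy p = x + y \<and> (\<exists>u. 0 \<le> u \<and> u \<le> 1 \<and> cy p = y + u) \<longleftrightarrow>
      (\<exists>u. 0 \<le> u \<and> u \<le> 1 \<and> cx p = x - u \<and> cy p = y + u)"
    by auto
  then show "p \<in> closed_segment (latt x y) (latt x y + vec_g) \<longleftrightarrow>
      cx p + cy p = x + y \<and> y \<le> cy p \<and> cy p \<le> y + 1"
    by (simp add: closed_segment_offset plane_eq_iff *)
qed

text \<open>The midpoint of a unit edge lies in the two triangles on either side of the edge and in no other. It is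
used to recognise two triangles from their common edge.\<close>

lemma midpoint_tri:
  fixes x y :: int
  shows "latt (x + 1/2) y \<in> tri t \<longleftrightarrow> t = Up (x, y) \<or> t = Down (x + 1, y - 1)"
    "latt x (y + 1/2) \<in> tri t \<longleftrightarrow> t = Up (x, y) \<or> t = Down (x, y)"
    "latt (x - 1/2) (y + 1/2) \<in> tri t \<longleftrightarrow> t = Up (x - 1, y) \<or> t = Down (x, y)"
proof -
  have *: "real_of_int m \<le> real_of_int n + 1/2 \<longleftrightarrow> m \<le> n"
    "real_of_int n + 1/2 \<le> real_of_int m \<longleftrightarrow> n + 1 \<le> m" for m n :: int
    by linarith+
  show "latt (x + 1/2) y \<in> tri t \<longleftrightarrow> t = Up (x, y) \<or> t = Down (x + 1, y - 1)"
  proof (cases t rule: tri.cases)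
    case (1 i j)
    then show ?thesis using *[of i x] *[of "x + y" "i + j + 1"] by auto
  next
    case (2 i j)
    then show ?thesis using *[of x i] *[of "i + j" "x + y"] by auto
  qed
  show "latt x (y + 1/2) \<in> tri t \<longleftrightarrow> t = Up (x, y) \<or> t = Down (x, y)"
  proof (cases t rule: tri.cases)
    case (1 i j)
    then show ?thesis using *[of j y] *[of "x + y" "i + j + 1"] by auto
  next
    case (2 i j)
    then show ?thesis using *[of y "j + 1"] *[of "i + j" "x + y"] by auto
  qed
  show "latt (x - 1/2) (y + 1/2) \<in> tri t \<longleftrightarrow> t = Up (x - 1, y) \<or> t = Down (x, y)"
  proof (cases t rule: tri.cases)
    case (1 i j)
    then show ?thesis using *[of i "x - 1"] *[of j y] by auto
  next
    case (2 i j)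
    then show ?thesis using *[of "x - 1" i] *[of y "j + 1"] by auto
  qed
qed

lemma nbrs_midpoint:
  assumes "q \<in> nbrs p"
  obtains m where "\<And>t. m \<in> tri t \<longleftrightarrow> t = Up p \<or> t = Down q"
proof (cases p)
  case (Pair x y)
  then consider "q = (x, y)" | "q = (x + 1, y)" | "q = (x + 1, y - 1)" using assms by auto
  then show thesis
  proof cases
    case 1
    with midpoint_tri(2)[of x y] Pair show ?thesis by (intro that) simp
  next
    case 2
    with midpoint_tri(3)[of "x + 1" y] Pair show ?thesis by (intro that) simp
  next
    case 3
    with midpoint_tri(1)[of x y] Pair show ?thesis by (intro that) simp
  qed
qed

lemma edge_eq_Int:
  fixes x y :: int
  shows "closed_segment (latt x y) (latt x y + vec_e) = tri (Up (x, y)) \<inter> tri (Down (x + 1, y - 1))"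
    "closed_segment (latt x y) (latt x y + vec_f) = tri (Up (x, y)) \<inter> tri (Down (x, y))"
    "closed_segment (latt x y) (latt x y + vec_g) = tri (Up (x - 1, y)) \<inter> tri (Down (x, y))"
  by (auto simp: edge_mem)

lemma unit_edges_iff:
  "E \<in> unit_edges \<longleftrightarrow> (\<exists>p. \<exists>q\<in>nbrs p. E = tri (Up p) \<inter> tri (Down q))"
proof -
  have "E \<in> unit_edges \<longleftrightarrow> (\<exists>(x::int) (y::int). \<exists>d\<in>{vec_e, vec_f, vec_g}.
      E = closed_segment (latt x y) (latt x y + d))"
    unfolding unit_edges_def tri_lattice_def latt_def by blast
  also have "\<dots> \<longleftrightarrow> (\<exists>x y. E = tri (Up (x, y)) \<inter> tri (Down (x + 1, y - 1)) \<or>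
      E = tri (Up (x, y)) \<inter> tri (Down (x, y)) \<or> E = tri (Up (x - 1, y)) \<inter> tri (Down (x, y)))"
    by (simp add: edge_eq_Int del: tri.simps)
  also have "\<dots> \<longleftrightarrow> (\<exists>x y. \<exists>q\<in>nbrs (x, y). E = tri (Up (x, y)) \<inter> tri (Down q))"
    by (simp del: tri.simps) (metis add_diff_cancel_right' diff_add_cancel)
  finally show ?thesis by (simp del: tri.simps nbrs.simps)
qed

text \<open>If two triangles meet in an edge, both contain the midpoint of this edge, so they are among the two
triangles adjacent to it. They cannot coincide, for then a triangle would be contained in both adjacent
triangles.\<close>

lemma lozenge_iff: "lozenge D \<longleftrightarrow> (\<exists>p. \<exists>q\<in>nbrs p. D = region {Up p, Down q})"
proof
  assume "lozenge D"
  then obtain s t where D: "tri s \<inter> tri t \<in> unit_edges" "D = tri s \<union> tri t"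
    by (auto simp: lozenge_def unit_triangles_eq)
  then obtain p q where pq: "q \<in> nbrs p" "tri s \<inter> tri t = tri (Up p) \<inter> tri (Down q)"
    unfolding unit_edges_iff by blast
  obtain m where m: "\<And>t. m \<in> tri t \<longleftrightarrow> t = Up p \<or> t = Down q"
    using nbrs_midpoint[OF pq(1)] by blast
  then have "m \<in> tri s \<inter> tri t"
    unfolding pq by simp
  then have "s \<in> {Up p, Down q}" "t \<in> {Up p, Down q}"
    using m by auto
  moreover have "s \<noteq> t"
  proof
    assume "s = t"
    then have "region {s} \<subseteq> region {Up p}" "region {s} \<subseteq> region {Down q}"
      using pq(2) by (auto simp: region_def simp del: tri.simps)
    then show False
      by (auto simp: region_subset_iff)
  qed
  ultimately have "{s, t} = {Up p, Down q}" by auto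
  moreover have "D = region {s, t}"
    by (simp add: region_def D)
  ultimately show "\<exists>p. \<exists>q\<in>nbrs p. D = region {Up p, Down q}"
    using pq(1) by metis
next
  assume "\<exists>p. \<exists>q\<in>nbrs p. D = region {Up p, Down q}"
  then obtain p q where "q \<in> nbrs p" and "D = region {Up p, Down q}"
    by blast
  then have D: "D = tri (Up p) \<union> tri (Down q)" and "q \<in> nbrs p"
    by (simp_all add: region_def del: tri.simps)
  then have "tri (Up p) \<inter> tri (Down q) \<in> unit_edges"
    unfolding unit_edges_iff by blast
  then show "lozenge D"
    unfolding lozenge_def unit_triangles_eq D by blast
qed

section \<open>Lozenge tilings as perfect matchings\<close>

text \<open>Perfect matchings of the upward triangles at \<open>U\<close> with the downward triangles at
\<open>W\<close>, as functions giving the partner of an upward triangle. Restricting to extensional functions makes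
the function unique for each matching, so that matchings can be counted.\<close>

definition matchings :: "(int \<times> int) set \<Rightarrow> (int \<times> int) set \<Rightarrow> (int \<times> int \<Rightarrow> int \<times> int) set" where
  "matchings U W = {h \<in> extensional U. bij_betw h U W \<and> (\<forall>p\<in>U. h p \<in> nbrs p)}"

definition tiling_of :: "(int \<times> int) set \<Rightarrow> (int \<times> int \<Rightarrow> int \<times> int) \<Rightarrow> plane set set" where
  "tiling_of U h = (\<lambda>p. region {Up p, Down (h p)}) ` U"

lemma Union_region: "\<Union>(region ` F) = region (\<Union>F)"
  by (auto simp: region_def)

lemma lozenge_tiling_tiling_of:
  assumes bij: "bij_betw h U W" and nbrs: "\<forall>p\<in>U. h p \<in> nbrs p"
  shows "lozenge_tiling (region (Up ` U \<union> Down ` W)) (tiling_of U h)"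
  unfolding lozenge_tiling_def
proof (intro conjI)
  show "\<forall>D\<in>tiling_of U h. lozenge D"
    using nbrs by (auto simp: tiling_of_def lozenge_iff simp del: nbrs.simps)
  have "interior (region {Up p, Down (h p)}) \<inter> interior (region {Up q, Down (h q)}) = {}"
    if "p \<in> U" "q \<in> U" "p \<noteq> q" for p q
  proof -
    have "h p \<noteq> h q"
      using that bij by (auto simp: bij_betw_def inj_on_eq_iff)
    then show ?thesis
      using that(3) by (simp add: interior_region_disjoint_iff)
  qed
  then show "pairwise (\<lambda>D D'. interior D \<inter> interior D' = {}) (tiling_of U h)"
    unfolding pairwise_def tiling_of_def by blast
  have "(\<Union>p\<in>U. {Up p, Down (h p)}) = Up ` U \<union> Down ` h ` U"
    by auto
  also have "h ` U = W"
    using bij by (simp add: bij_betw_def)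
  finally show "\<Union>(tiling_of U h) = region (Up ` U \<union> Down ` W)"
    using Union_region[of "(\<lambda>p. {Up p, Down (h p)}) ` U"]
    by (simp add: tiling_of_def image_image)
qed

text \<open>The lozenges of a tiling define a relation between upward and downward triangles. Disjointness of
interiors makes the relation one-to-one, and the union being the whole region makes it total on both sides.\<close>

lemma lozenge_tiling_imp_tiling_of:
  assumes "lozenge_tiling (region (Up ` U \<union> Down ` W)) \<D>"
  obtains h where "h \<in> matchings U W" "\<D> = tiling_of U h"
proof -
  define Q where "Q = {(p, q). q \<in> nbrs p \<and> region {Up p, Down q} \<in> \<D>}"
  have \<D>: "\<D> = (\<lambda>(p, q). region {Up p, Down q}) ` Q"
    using assms by (force simp: lozenge_tiling_def lozenge_iff Q_def simp del: nbrs.simps)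
  have disj: "{Up p, Down q} = {Up p', Down q'} \<or> {Up p, Down q} \<inter> {Up p', Down q'} = {}"
    if "(p, q) \<in> Q" "(p', q') \<in> Q" for p q p' q'
  proof -
    have "region {Up p, Down q} \<in> \<D>" "region {Up p', Down q'} \<in> \<D>"
      using that by (simp_all add: Q_def)
    then have "region {Up p, Down q} = region {Up p', Down q'} \<or>
        interior (region {Up p, Down q}) \<inter> interior (region {Up p', Down q'}) = {}"
      using assms unfolding lozenge_tiling_def pairwise_def by blast
    then show ?thesis
      by (simp only: region_eq_iff interior_region_disjoint_iff)
  qed
  have right_unique: "q = q'" if "(p, q) \<in> Q" "(p, q') \<in> Q" for p q q'
    using disj[OF that] by auto
  have left_unique: "p = p'" if "(p, q) \<in> Q" "(p', q) \<in> Q" for p p' q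
    using disj[OF that] by auto
  have "region (Up ` U \<union> Down ` W) = \<Union>\<D>"
    using assms by (simp add: lozenge_tiling_def)
  also have "\<dots> = region (\<Union>((\<lambda>(p, q). {Up p, Down q}) ` Q))"
    unfolding \<D> Union_region[symmetric] by (simp add: image_image case_prod_unfold)
  also have "(\<Union>((\<lambda>(p, q). {Up p, Down q}) ` Q)) = Up ` fst ` Q \<union> Down ` snd ` Q"
    by force
  finally have *: "Up ` U \<union> Down ` W = Up ` fst ` Q \<union> Down ` snd ` Q"
    unfolding region_eq_iff .
  have U: "p \<in> U \<longleftrightarrow> (\<exists>q. (p, q) \<in> Q)" for p
  proof -
    have "Up p \<in> Up ` fst ` Q \<union> Down ` snd ` Q \<longleftrightarrow> (\<exists>q. (p, q) \<in> Q)" by force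
    then show ?thesis unfolding *[symmetric] by blast
  qed
  have W: "q \<in> W \<longleftrightarrow> (\<exists>p. (p, q) \<in> Q)" for q
  proof -
    have "Down q \<in> Up ` fst ` Q \<union> Down ` snd ` Q \<longleftrightarrow> (\<exists>p. (p, q) \<in> Q)" by force
    then show ?thesis unfolding *[symmetric] by blast
  qed
  define h where "h = (\<lambda>p\<in>U. SOME q. (p, q) \<in> Q)"
  have h: "(p, h p) \<in> Q" if "p \<in> U" for p
  proof -
    from that have "\<exists>q. (p, q) \<in> Q" by (simp only: U)
    from someI_ex[OF this] show ?thesis using that by (simp add: h_def)
  qed
  have hQ: "h p = q" if "(p, q) \<in> Q" for p q
  proof -
    have "p \<in> U" using that U by blast
    from right_unique[OF h[OF this] that] show ?thesis .
  qed
  have "bij_betw h U W"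
    unfolding bij_betw_def
  proof
    show "inj_on h U"
      using h left_unique by (metis inj_onI)
    show "h ` U = W"
    proof
      show "h ` U \<subseteq> W" using h W by blast
      show "W \<subseteq> h ` U"
      proof
        fix q assume "q \<in> W"
        then obtain p where "(p, q) \<in> Q" using W by blast
        then have "p \<in> U" "h p = q" by (auto simp only: U intro: hQ)
        then show "q \<in> h ` U" by blast
      qed
    qed
  qed
  moreover have "\<forall>p\<in>U. h p \<in> nbrs p"
    using h by (auto simp: Q_def simp del: nbrs.simps)
  moreover have "h \<in> extensional U"
    by (simp add: h_def)
  ultimately have "h \<in> matchings U W"
    by (simp add: matchings_def)
  moreover have "Q = (\<lambda>p. (p, h p)) ` U"
  proof (intro equalityI subsetI)
    fix r assume "r \<in> Q"
    then obtain p q where r: "r = (p, q)" "(p, q) \<in> Q" by (cases r) auto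
    then have "p \<in> U" using U by blast
    then show "r \<in> (\<lambda>p. (p, h p)) ` U" using r hQ[OF r(2)] by (intro image_eqI[of _ _ p]) auto
  qed (use h in blast)
  then have "\<D> = tiling_of U h"
    by (simp add: \<D> tiling_of_def image_image)
  ultimately show thesis
    by (rule that)
qed

lemma inj_on_tiling_of: "inj_on (tiling_of U) (matchings U W)"
proof (rule inj_onI)
  fix h k assume hk: "h \<in> matchings U W" "k \<in> matchings U W" and eq: "tiling_of U h = tiling_of U k"
  show "h = k"
  proof (rule extensionalityI[of h U])
    show "h \<in> extensional U" "k \<in> extensional U"
      using hk by (auto simp: matchings_def)
    fix p assume "p \<in> U"
    then have "region {Up p, Down (h p)} \<in> tiling_of U k"
      unfolding eq[symmetric] by (simp add: tiling_of_def)
    then show "h p = k p"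
      by (auto simp: tiling_of_def region_eq_iff doubleton_eq_iff)
  qed
qed

lemma num_lozenge_tilings_region:
  "num_lozenge_tilings (region (Up ` U \<union> Down ` W)) = card (matchings U W)"
proof -
  have "{\<D>. lozenge_tiling (region (Up ` U \<union> Down ` W)) \<D>} = tiling_of U ` matchings U W"
  proof (intro equalityI subsetI)
    fix \<D> assume "\<D> \<in> {\<D>. lozenge_tiling (region (Up ` U \<union> Down ` W)) \<D>}"
    then obtain h where "h \<in> matchings U W" "\<D> = tiling_of U h"
      using lozenge_tiling_imp_tiling_of by blast
    then show "\<D> \<in> tiling_of U ` matchings U W" by blast
  next
    fix \<D> assume "\<D> \<in> tiling_of U ` matchings U W"
    then show "\<D> \<in> {\<D>. lozenge_tiling (region (Up ` U \<union> Down ` W)) \<D>}"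
      using lozenge_tiling_tiling_of unfolding matchings_def by blast
  qed
  then show ?thesis
    by (simp add: num_lozenge_tilings_def card_image inj_on_tiling_of)
qed

section \<open>The region without its staircases\<close>

lemma hull_vertex_combination:
  fixes S :: "'a::real_vector set"
  assumes "convex S" "p \<in> S" "q \<in> S" "0 \<le> u" "u \<le> 1"
  shows "p + u *\<^sub>R (q - p) \<in> S"
  using convexD_alt[OF assms] by (simp add: algebra_simps)

text \<open>A point of a trapezoid with horizontal parallel sides lies on a horizontal segment joining the two
legs. The parameter \<open>u\<close> is the relative height of that segment. The hexagon is treated as two such
trapezoids, glued along the line joining the western and the eastern corner.\<close>

lemma convex_trapezoid:
  assumes S: "convex S"
    and corners: "latt l0 y0 \<in> S" "latt r0 y0 \<in> S" "latt l1 y1 \<in> S" "latt r1 y1 \<in> S"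
    and u: "0 \<le> u" "u \<le> 1" and y: "cy p = y0 + u * (y1 - y0)"
    and x: "l0 + u * (l1 - l0) \<le> cx p" "cx p \<le> r0 + u * (r1 - r0)"
  shows "p \<in> S"
proof -
  define l where "l = l0 + u * (l1 - l0)"
  define r where "r = r0 + u * (r1 - r0)"
  have "latt l0 y0 + u *\<^sub>R (latt l1 y1 - latt l0 y0) \<in> S" "latt r0 y0 + u *\<^sub>R (latt r1 y1 - latt r0 y0) \<in> S"
    using S corners u by (auto intro: hull_vertex_combination)
  moreover have "latt l0 y0 + u *\<^sub>R (latt l1 y1 - latt l0 y0) = latt l (cy p)"
    "latt r0 y0 + u *\<^sub>R (latt r1 y1 - latt r0 y0) = latt r (cy p)"
    by (simp_all add: plane_eq_iff l_def r_def y)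
  ultimately have lr: "latt l (cy p) \<in> S" "latt r (cy p) \<in> S" by simp_all
  have "p \<in> closed_segment (latt l (cy p)) (latt r (cy p))"
  proof (cases "l = r")
    case True
    then show ?thesis using x by (simp add: l_def r_def plane_eq_iff)
  next
    case False
    then have "l < r" using x by (simp add: l_def r_def)
    define v where "v = (cx p - l) / (r - l)"
    have "0 \<le> v" "v \<le> 1" using x \<open>l < r\<close> by (auto simp: v_def l_def r_def)
    moreover have "cx p = l + v * (r - l)" using \<open>l < r\<close> by (simp add: v_def)
    then have "p = (1 - v) *\<^sub>R latt l (cy p) + v *\<^sub>R latt r (cy p)"
      by (simp add: plane_eq_iff algebra_simps)
    ultimately show ?thesis by (auto simp: in_segment)
  qed
  then show ?thesis
    using closed_segment_subset[OF lr S] by blast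
qed

lemma hexagon_eq:
  assumes "0 < a"
  shows "hexagon a b a = hex_polygon (- real a) (real b) 0 (2 * real a) 0 (real a + real b)"
proof
  let ?V = "{0, real b *\<^sub>R vec_e, real b *\<^sub>R vec_e + real a *\<^sub>R vec_f,
      real b *\<^sub>R vec_e + real a *\<^sub>R vec_f + real a *\<^sub>R vec_g,
      real a *\<^sub>R vec_f + real a *\<^sub>R vec_g, real a *\<^sub>R vec_g}"
  show "hexagon a b a \<subseteq> hex_polygon (- real a) (real b) 0 (2 * real a) 0 (real a + real b)"
    unfolding hexagon_def by (intro hull_minimal convex_hex_polygon) (auto simp: hex_polygon_def)
  have V: "?V = {latt 0 0, latt b 0, latt b a, latt (real b - a) (2 * a), latt (- real a) (2 * a),
      latt (- real a) a}"
    by (intro arg_cong2[of _ _ _ _ insert]) (auto simp: plane_eq_iff)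
  have S: "convex (hexagon a b a)"
    by (simp add: hexagon_def)
  have "?V \<subseteq> hexagon a b a"
    unfolding hexagon_def by (rule hull_subset)
  then have verts: "latt 0 0 \<in> hexagon a b a" "latt b 0 \<in> hexagon a b a" "latt b a \<in> hexagon a b a"
      "latt (real b - a) (2 * a) \<in> hexagon a b a" "latt (- real a) (2 * a) \<in> hexagon a b a"
      "latt (- real a) a \<in> hexagon a b a"
    unfolding V by simp_all
  show "hex_polygon (- real a) (real b) 0 (2 * real a) 0 (real a + real b) \<subseteq> hexagon a b a"
  proof
    fix p assume p: "p \<in> hex_polygon (- real a) (real b) 0 (2 * real a) 0 (real a + real b)"
    show "p \<in> hexagon a b a"
    proof (cases "cy p \<le> a")
      case True
      define u where "u = cy p / a"
      have "0 \<le> u" "u \<le> 1" "u * a = cy p"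
        using p True assms by (auto simp: hex_polygon_def u_def)
      then show ?thesis
        using p by (intro convex_trapezoid[OF S verts(1,2,6,3)]) (auto simp: hex_polygon_def)
    next
      case False
      define u where "u = cy p / a - 1"
      have "0 \<le> u" "u \<le> 1" "u * a = cy p - a"
        using p False assms by (auto simp: hex_polygon_def u_def field_simps)
      then show ?thesis
        using p by (intro convex_trapezoid[OF S verts(6,3,5,4)]) (auto simp: hex_polygon_def)
    qed
  qed
qed

text \<open>All cells of the two staircases are lozenges with a horizontal inner edge, consisting of the upward
triangle at \<open>(x, y)\<close> and the downward triangle below it.\<close>

lemma vertical_lozenge_eq_hex_polygon:
  "region {Up (x, y), Down (x + 1, y - 1)} = hex_polygon x (x + 1) (y - 1) (y + 1) (x + y) (x + y + 1)"
  by (auto simp: region_def hex_polygon_def)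

lemma vertical_lozenge_eq_hull:
  "convex hull {latt x y, latt (x + 1) (y - 1), latt (x + 1) y, latt x (y + 1)} =
     region {Up (x, y), Down (x + 1, y - 1)}" (is "convex hull ?V = _")
proof
  show "convex hull ?V \<subseteq> region {Up (x, y), Down (x + 1, y - 1)}"
    unfolding vertical_lozenge_eq_hex_polygon
    by (intro hull_minimal convex_hex_polygon) (auto simp: hex_polygon_def)
  have "tri (Up (x, y)) \<subseteq> convex hull ?V"
    unfolding tri_Up_hull by (rule hull_mono) (auto simp: plane_eq_iff)
  moreover have "tri (Down (x + 1, y - 1)) \<subseteq> convex hull ?V"
    unfolding tri_Down_hull by (rule hull_mono) (auto simp: plane_eq_iff)
  ultimately show "region {Up (x, y), Down (x + 1, y - 1)} \<subseteq> convex hull ?V"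
    by (simp add: region_def)
qed

definition vertical_lozenge_triangles :: "(int \<times> int) set \<Rightarrow> triangle set" where
  "vertical_lozenge_triangles P = Up ` P \<union> Down ` (\<lambda>(x, y). (x + 1, y - 1)) ` P"

lemma Union_vertical_lozenges:
  "(\<Union>(x, y)\<in>P. region {Up (x, y), Down (x + 1, y - 1)}) = region (vertical_lozenge_triangles P)"
  by (force simp: vertical_lozenge_triangles_def region_def simp del: tri.simps)

lemma west_cell:
  "cell (real a *\<^sub>R vec_g) (- vec_g) vec_f i j =
     (case (int i - 1 - a, int a - i + j) of (x, y) \<Rightarrow> region {Up (x, y), Down (x + 1, y - 1)})"
  unfolding cell_def prod.case vertical_lozenge_eq_hull[symmetric]
  by (rule arg_cong[where f = "\<lambda>V. convex hull V"], intro arg_cong2[of _ _ _ _ insert])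
    (auto simp: plane_eq_iff algebra_simps)

lemma east_cell:
  "cell (real b *\<^sub>R vec_e + real a *\<^sub>R vec_f) (- vec_f) vec_g i j =
     (case (int b - j, int a - i + j) of (x, y) \<Rightarrow> region {Up (x, y), Down (x + 1, y - 1)})"
proof -
  have swap: "{P, Q, R, S} = {R', Q', P', S'}"
    if "P = P'" "Q = Q'" "R = R'" "S = S'" for P Q R S P' Q' R' S' :: plane
    using that by auto
  show ?thesis
    unfolding cell_def prod.case vertical_lozenge_eq_hull[symmetric]
    by (rule arg_cong[where f = "\<lambda>V. convex hull V"], rule swap)
      (auto simp: plane_eq_iff algebra_simps)
qed

text \<open>The upward halves of the staircase cells. In terms of \<open>2 x + y\<close>, which is twice the
Cartesian abscissa of the lattice point, each staircase consists of what lies beyond a vertical line inside the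
hexagon.\<close>

definition west_ups :: "nat \<Rightarrow> (int \<times> int) set" where
  "west_ups a = {(x, y). - int a \<le> x \<and> 0 \<le> x + y \<and> 2 * x + y \<le> - 2}"

definition east_ups :: "nat \<Rightarrow> nat \<Rightarrow> (int \<times> int) set" where
  "east_ups a b = {(x, y). x < int b \<and> x + y < int a + int b \<and> 2 * int b \<le> 2 * x + y}"

lemma max_staircase_eq_region:
  assumes cell: "\<And>i j. cell V s t i j = (case f (i, j) of (x, y) \<Rightarrow> region {Up (x, y), Down (x + 1, y - 1)})"
    and P: "P = f ` {(i, j). 1 \<le> i \<and> 1 \<le> j \<and> i + j \<le> min p q}"
  shows "max_staircase V p q s t = region (vertical_lozenge_triangles P)"
proof -
  have "max_staircase V p q s t = (\<Union>(i, j)\<in>{(i, j). 1 \<le> i \<and> 1 \<le> j \<and> i + j \<le> min p q}. cell V s t i j)"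
    unfolding max_staircase_def by blast
  also have "\<dots> = (\<Union>(x, y)\<in>P. region {Up (x, y), Down (x + 1, y - 1)})"
    unfolding P cell by (simp add: image_image case_prod_unfold)
  finally show ?thesis
    by (simp only: Union_vertical_lozenges)
qed

lemma west_staircase_eq: "west_staircase a b a = region (vertical_lozenge_triangles (west_ups a))"
proof -
  have "west_ups a = (\<lambda>(i, j). (int i - 1 - a, int a - i + j)) ` {(i, j). 1 \<le> i \<and> 1 \<le> j \<and> i + j \<le> a}"
  proof (intro equalityI subsetI)
    fix p assume p: "p \<in> west_ups a"
    obtain x y where xy: "p = (x, y)" by force
    show "p \<in> (\<lambda>(i, j). (int i - 1 - a, int a - i + j)) ` {(i, j). 1 \<le> i \<and> 1 \<le> j \<and> i + j \<le> a}"
      using p unfolding xy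
      by (intro image_eqI[of _ _ "(nat (x + a + 1), nat (x + y + 1))"]) (auto simp: west_ups_def)
  qed (auto simp: west_ups_def)
  then show ?thesis
    unfolding west_staircase_def by (intro max_staircase_eq_region) (simp_all add: west_cell)
qed

lemma east_staircase_eq: "east_staircase a b a = region (vertical_lozenge_triangles (east_ups a b))"
proof -
  have "east_ups a b = (\<lambda>(i, j). (int b - j, int a - i + j)) ` {(i, j). 1 \<le> i \<and> 1 \<le> j \<and> i + j \<le> a}"
  proof (intro equalityI subsetI)
    fix p assume p: "p \<in> east_ups a b"
    obtain x y where xy: "p = (x, y)" by force
    show "p \<in> (\<lambda>(i, j). (int b - j, int a - i + j)) ` {(i, j). 1 \<le> i \<and> 1 \<le> j \<and> i + j \<le> a}"
      using p unfolding xy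
      by (intro image_eqI[of _ _ "(nat (int a + b - x - y), nat (b - x))"]) (auto simp: east_ups_def)
  qed (auto simp: east_ups_def)
  then show ?thesis
    unfolding east_staircase_def by (intro max_staircase_eq_region) (simp_all add: east_cell)
qed

text \<open>The positions are those for which all three vertices satisfy the inequalities of the hexagon.\<close>

definition hexagon_tris :: "nat \<Rightarrow> nat \<Rightarrow> triangle set" where
  "hexagon_tris a b =
     Up ` {(x, y). 0 \<le> y \<and> y < 2 * int a \<and> - int a \<le> x \<and> x < int b \<and> 0 \<le> x + y \<and> x + y < int a + int b} \<union>
     Down ` {(x, y). 0 \<le> y \<and> y < 2 * int a \<and> - int a < x \<and> x \<le> int b \<and> 0 \<le> x + y \<and> x + y < int a + int b}"

lemma hex_polygon_eq_region:
  assumes "0 < a" "0 < b"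
  shows "hex_polygon (- real a) (real b) 0 (2 * real a) 0 (real a + real b) = region (hexagon_tris a b)"
proof
  show "region (hexagon_tris a b) \<subseteq> hex_polygon (- real a) (real b) 0 (2 * real a) 0 (real a + real b)"
    by (auto simp: region_def hexagon_tris_def hex_polygon_def)
  show "hex_polygon (- real a) (real b) 0 (2 * real a) 0 (real a + real b) \<subseteq> region (hexagon_tris a b)"
  proof
    fix p assume p: "p \<in> hex_polygon (- real a) (real b) 0 (2 * real a) 0 (real a + real b)"
    \<comment> \<open>Lower the coordinates to integers, staying inside the parallelogram around the hexagon even on its
      eastern and upper sides. The two triangles of the resulting unit parallelogram contain the point. Where
      it sticks out of the hexagon across the southwestern or northeastern side, the case distinction below picks a
      triangle inside.\<close>
    define i where "i = min \<lfloor>cx p\<rfloor> (int b - 1)"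
    define j where "j = min \<lfloor>cy p\<rfloor> (2 * int a - 1)"
    have i: "i \<le> cx p" "cx p \<le> i + 1" "- int a \<le> i" "i < int b"
      using p assms by (auto simp: i_def hex_polygon_def min_def) linarith+
    have j: "j \<le> cy p" "cy p \<le> j + 1" "0 \<le> j" "j < 2 * int a"
      using p assms by (auto simp: j_def hex_polygon_def min_def) linarith+
    have sum: "0 \<le> cx p + cy p" "cx p + cy p \<le> a + b"
      using p by (auto simp: hex_polygon_def)
    have "- 2 \<le> i + j" "i + j \<le> int a + int b"
      using i j sum by linarith+
    then consider "i + j = - 2" | "i + j = - 1" | "i + j = int a + int b"
      | "i + j = int a + int b - 1" | "0 \<le> i + j" "i + j + 1 < int a + int b"
      by linarith
    then obtain t where "t \<in> hexagon_tris a b" "p \<in> tri t"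
    proof cases
      case 1
      then show ?thesis
        using i j sum by (intro that[of "Up (i + 1, j + 1)"]) (auto simp: hexagon_tris_def)
    next
      case 2
      then show ?thesis
        using i j sum by (intro that[of "Down (i + 1, j)"]) (auto simp: hexagon_tris_def)
    next
      case 3
      then show ?thesis
        using i j sum by (intro that[of "Down (i, j - 1)"]) (auto simp: hexagon_tris_def)
    next
      case 4
      then show ?thesis
        using i j sum by (intro that[of "Up (i, j)"]) (auto simp: hexagon_tris_def)
    next
      case 5
      then show ?thesis
        using i j that[of "Up (i, j)"] that[of "Down (i + 1, j)"]
        by (cases "cx p + cy p \<le> i + j + 1") (auto simp: hexagon_tris_def)
    qed
    then show "p \<in> region (hexagon_tris a b)"
      by (auto simp: region_def)
  qed
qed

lemma finite_hexagon_tris: "finite (hexagon_tris a b)"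
proof -
  have "{(x, y). 0 \<le> y \<and> y < 2 * int a \<and> - int a \<le> x \<and> x < int b \<and> 0 \<le> x + y \<and> x + y < int a + int b}
      \<subseteq> {- int a..int b} \<times> {0..2 * int a}"
    "{(x, y). 0 \<le> y \<and> y < 2 * int a \<and> - int a < x \<and> x \<le> int b \<and> 0 \<le> x + y \<and> x + y < int a + int b}
      \<subseteq> {- int a..int b} \<times> {0..2 * int a}"
    by auto
  from this[THEN finite_subset] show ?thesis
    by (simp add: hexagon_tris_def)
qed

text \<open>Set difference of regions loses the boundary shared with the removed part; taking the closure restores
exactly that, since open parts of the remaining triangles are untouched.\<close>

lemma closure_region_Diff:
  assumes "finite S"
  shows "closure (region S - region T) = region (S - T)"
proof
  have "closed (region (S - T))"
    using assms closed_tri by (auto simp: region_def intro!: closed_UN)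
  moreover have "region S - region T \<subseteq> region (S - T)"
    by (auto simp: region_def)
  ultimately show "closure (region S - region T) \<subseteq> region (S - T)"
    by (simp add: closure_minimal)
  show "region (S - T) \<subseteq> closure (region S - region T)"
  proof
    fix p assume "p \<in> region (S - T)"
    then obtain t where t: "t \<in> S" "t \<notin> T" "p \<in> tri t"
      by (auto simp: region_def)
    have "open_tri t \<subseteq> region S - region T"
    proof
      fix q assume q: "q \<in> open_tri t"
      then have "q \<in> region S" using t open_tri_subset by (force simp: region_def)
      moreover have "q \<notin> region T" using tri_unique[OF q] t by (auto simp: region_def)
      ultimately show "q \<in> region S - region T" by simp
    qed
    then show "p \<in> closure (region S - region T)"
      using closure_mono tri_subset_closure t(3) by blast
  qed
qed

text \<open>The triangles of the stack of \<open>a\<close> hexagons with sides \<open>b, 1, 1, b, 1, 1\<close>. The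
centre of a triangle at \<open>(x, y)\<close> has twice its Cartesian abscissa equal to \<open>2 x + y + 1\<close>
for an upward and to \<open>2 x + y\<close> for a downward triangle, so in both cases the last two bounds say that
the abscissa of the centre is between \<open>0\<close> and \<open>b\<close>.\<close>

definition ups :: "nat \<Rightarrow> nat \<Rightarrow> (int \<times> int) set" where
  "ups a b = {(x, y). 0 \<le> y \<and> y < 2 * int a \<and> - 1 \<le> 2 * x + y \<and> 2 * x + y \<le> 2 * int b - 1}"

definition downs :: "nat \<Rightarrow> nat \<Rightarrow> (int \<times> int) set" where
  "downs a b = {(x, y). 0 \<le> y \<and> y < 2 * int a \<and> 0 \<le> 2 * x + y \<and> 2 * x + y \<le> 2 * int b}"

text \<open>Within the hexagon, removing both staircases leaves only the bounds on \<open>2 x + y\<close>. For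
downward triangles these bounds are shifted by one, because the downward half of the cell at \<open>(x, y)\<close>
is at \<open>(x + 1, y - 1)\<close>. Conversely, the bounds on \<open>y\<close> and \<open>2 x + y\<close> imply
the remaining inequalities of the hexagon.\<close>

lemma hexagon_o_eq:
  assumes "0 < a" "0 < b"
  shows "hexagon_o a b a = region (Up ` ups a b \<union> Down ` downs a b)"
proof -
  let ?W = "vertical_lozenge_triangles (west_ups a)" and ?E = "vertical_lozenge_triangles (east_ups a b)"
  have Up_iff: "Up (x, y) \<in> vertical_lozenge_triangles P \<longleftrightarrow> (x, y) \<in> P" for x y P
    by (auto simp: vertical_lozenge_triangles_def)
  have Down_iff: "Down (x, y) \<in> vertical_lozenge_triangles P \<longleftrightarrow> (x - 1, y + 1) \<in> P" for x y P
    by (force simp: vertical_lozenge_triangles_def)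
  have "hexagon_tris a b - (?W \<union> ?E) = Up ` ups a b \<union> Down ` downs a b" (is "?L = ?R")
  proof (rule set_eqI)
    fix t
    show "t \<in> ?L \<longleftrightarrow> t \<in> ?R"
    proof (cases t rule: tri.cases)
      case (1 x y)
      then show ?thesis
        unfolding 1 Diff_iff Un_iff Up_iff
        by (auto simp: hexagon_tris_def west_ups_def east_ups_def ups_def)
    next
      case (2 x y)
      then show ?thesis
        unfolding 2 Diff_iff Un_iff Down_iff
        by (auto simp: hexagon_tris_def west_ups_def east_ups_def downs_def)
    qed
  qed
  moreover have "region ?W \<union> region ?E = region (?W \<union> ?E)"
    by (auto simp: region_def)
  ultimately show ?thesis
    unfolding hexagon_o_def hexagon_eq[OF assms(1)] hex_polygon_eq_region[OF assms]
      west_staircase_eq east_staircase_eq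
    by (simp add: closure_region_Diff finite_hexagon_tris)
qed

section \<open>Matchings of the stack\<close>

text \<open>The matching of one small hexagon in which the lozenge crossing the middle line has position
\<open>K\<close>. For \<open>y = 2 m\<close> or \<open>y = 2 m + 1\<close>, the number \<open>u = x + m\<close> is
the first lattice coordinate relative to the lower left corner \<open>(- m, 2 m)\<close> of hexagon number
\<open>m\<close>. In the lower row \<open>u\<close> ranges over \<open>{0..<b}\<close> for upward and over
\<open>{0..b}\<close> for downward triangles; in the upper row it ranges over \<open>{-1..<b}\<close> and
\<open>{0..<b}\<close>. The lower upward triangles leave out the downward triangle \<open>K\<close>, whose partner
is the upward triangle \<open>K - 1\<close> on top of it.\<close>

fun row_matching :: "int \<Rightarrow> int \<times> int \<Rightarrow> int \<times> int" where
  "row_matching K (x, y) =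
     (let u = x + y div 2 in
      if even y then (if u < K then (x, y) else (x + 1, y))
      else if u < K - 1 then (x + 1, y)
      else if u = K - 1 then (x + 1, y - 1)
      else (x, y))"

definition stack_matching :: "(int \<Rightarrow> int) \<Rightarrow> int \<times> int \<Rightarrow> int \<times> int" where
  "stack_matching k p = row_matching (k (snd p div 2)) p"

fun row_matching_inv :: "int \<Rightarrow> int \<times> int \<Rightarrow> int \<times> int" where
  "row_matching_inv K (x, y) =
     (let w = x + y div 2 in
      if even y then (if w < K then (x, y) else if w = K then (x - 1, y + 1) else (x - 1, y))
      else if w < K then (x - 1, y) else (x, y))"

lemma row_matching_nbrs: "row_matching K p \<in> nbrs p"
  by (cases p) (simp add: Let_def)

lemma row_matching_inverses:
  "row_matching_inv K (row_matching K p) = p" "row_matching K (row_matching_inv K p) = p"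
  by (cases p; cases "even (snd p)"; auto simp: Let_def elim!: evenE oddE)+

lemma row_matching_row: "snd (row_matching K p) div 2 = snd p div 2"
  "snd (row_matching_inv K p) div 2 = snd p div 2"
  by (cases p; cases "even (snd p)"; auto simp: Let_def elim!: evenE oddE)+

lemma row_matching_in_downs:
  assumes "0 \<le> K" "K \<le> int b" "p \<in> ups a b"
  shows "row_matching K p \<in> downs a b"
  using assms by (cases p; cases "even (snd p)"; auto simp: Let_def ups_def downs_def elim!: evenE oddE; presburger)

lemma row_matching_inv_in_ups:
  assumes "0 \<le> K" "K \<le> int b" "p \<in> downs a b"
  shows "row_matching_inv K p \<in> ups a b"
  using assms by (cases p; cases "even (snd p)"; auto simp: Let_def ups_def downs_def elim!: evenE oddE; presburger)

lemma row_in_range: "p \<in> ups a b \<Longrightarrow> snd p div 2 \<in> {0..<int a}" "p \<in> downs a b \<Longrightarrow> snd p div 2 \<in> {0..<int a}"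
  by (auto simp: ups_def downs_def)

lemma bij_stack_matching:
  assumes "k \<in> {0..<int a} \<rightarrow> {0..int b}"
  shows "bij_betw (stack_matching k) (ups a b) (downs a b)"
proof (rule bij_betw_byWitness[where f' = "\<lambda>p. row_matching_inv (k (snd p div 2)) p"])
  have K: "0 \<le> k (snd p div 2)" "k (snd p div 2) \<le> int b" if "p \<in> ups a b \<union> downs a b" for p
  proof -
    have "snd p div 2 \<in> {0..<int a}"
      using that row_in_range by blast
    then have "k (snd p div 2) \<in> {0..int b}"
      using assms by blast
    then show "0 \<le> k (snd p div 2)" "k (snd p div 2) \<le> int b" by auto
  qed
  show "stack_matching k ` ups a b \<subseteq> downs a b"
    using K row_matching_in_downs unfolding stack_matching_def by blast
  show "(\<lambda>p. row_matching_inv (k (snd p div 2)) p) ` downs a b \<subseteq> ups a b"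
    using K row_matching_inv_in_ups by blast
qed (simp_all add: stack_matching_def row_matching_row row_matching_inverses)

text \<open>The threshold of a hexagon can be read off from its matching: the upward triangle \<open>K - 1\<close>
of the upper row is the only one with its partner below.\<close>

lemma stack_matching_eqD:
  assumes k: "k \<in> {0..<int a} \<rightarrow>\<^sub>E {0..int b}" "k' \<in> {0..<int a} \<rightarrow>\<^sub>E {0..int b}"
    and eq: "\<And>p. p \<in> ups a b \<Longrightarrow> stack_matching k p = stack_matching k' p"
  shows "k = k'"
proof (rule PiE_ext[OF k])
  fix m assume m: "m \<in> {0..<int a}"
  define p where "p = (k m - 1 - m, 2 * m + 1)"
  have "0 \<le> k m" "k m \<le> int b"
    using PiE_mem[OF k(1) m] by auto
  then have "p \<in> ups a b"
    using m by (auto simp: p_def ups_def)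
  from eq[OF this] show "k m = k' m"
    by (auto simp: p_def stack_matching_def Let_def split: if_splits)
qed

text \<open>Used for the lower row of a small hexagon, where \<open>P u\<close> says that the upward triangle
\<open>u\<close> is matched to its right; its right neighbour \<open>u + 1\<close> is then deprived of its left
partner.\<close>

lemma monotone_threshold:
  fixes b :: nat and P :: "int \<Rightarrow> bool"
  assumes "\<And>u. 0 \<le> u \<Longrightarrow> u + 1 < int b \<Longrightarrow> P u \<Longrightarrow> P (u + 1)"
  shows "\<exists>K\<in>{0..int b}. \<forall>u\<in>{0..<int b}. P u \<longleftrightarrow> K \<le> u"
  using assms
proof (induction b)
  case (Suc b)
  then obtain K where K: "K \<in> {0..int b}" "\<forall>u\<in>{0..<int b}. P u \<longleftrightarrow> K \<le> u"
    by auto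
  have Kb: "P (int b)" if "K < int b"
  proof -
    have "P (int b - 1)" using K that by auto
    then show ?thesis using Suc.prems[of "int b - 1"] K(1) that by auto
  qed
  show ?case
  proof (cases "P (int b)")
    case True
    have "P u \<longleftrightarrow> K \<le> u" if "u \<in> {0..<int (Suc b)}" for u
      using that True K by (cases "u = int b") auto
    then show ?thesis using K(1) by (intro bexI[of _ K]) auto
  next
    case False
    have "P u \<longleftrightarrow> int b + 1 \<le> u" if "u \<in> {0..<int (Suc b)}" for u
      using that False Kb K by (cases "u = int b") auto
    then show ?thesis by (intro bexI[of _ "int b + 1"]) auto
  qed
qed simp

text \<open>Suppose that no upward triangle of the lower row has its partner below. The lower row then has a
threshold \<open>K\<close>, and all its downward triangles other than \<open>K\<close> are taken. So in the upper
row only the upward triangle \<open>K - 1\<close> can have its partner below. The leftmost triangle of the upper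
row has no left partner, which forces everything left of \<open>K - 1\<close> to be matched to the right, one after
the other; symmetrically from the right end. Finally the two partners of \<open>K - 1\<close> in its own row are
taken or missing.\<close>

lemma matching_row:
  assumes h: "h \<in> matchings (ups a b) (downs a b)" and m: "0 \<le> m" "m < int a"
    and base: "\<And>x. (x, 2 * m) \<in> ups a b \<Longrightarrow> h (x, 2 * m) \<noteq> (x + 1, 2 * m - 1)"
  shows "\<exists>K\<in>{0..int b}. \<forall>p\<in>ups a b. snd p div 2 = m \<longrightarrow> h p = row_matching K p"
proof -
  have inj: "p = q" if "h p = h q" "p \<in> ups a b" "q \<in> ups a b" for p q
    using h that by (auto simp: matchings_def bij_betw_def inj_on_def)
  have down: "h p \<in> downs a b" and nbr: "h p \<in> nbrs p" if "p \<in> ups a b" for p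
    using h that by (auto simp: matchings_def bij_betw_def)
  \<comment> \<open>Positions in the lower and in the upper row of hexagon number \<open>m\<close>, by the coordinate relative to its corner.\<close>
  define e where "e u = (u - m, 2 * m)" for u
  define o' where "o' u = (u - m, 2 * m + 1)" for u
  have e_ups: "e u \<in> ups a b \<longleftrightarrow> 0 \<le> u \<and> u < int b" for u
    using m by (auto simp: e_def ups_def)
  have o_ups: "o' u \<in> ups a b \<longleftrightarrow> - 1 \<le> u \<and> u < int b" for u
    using m by (auto simp: o'_def ups_def)
  have o_downs: "o' u \<in> downs a b \<longleftrightarrow> 0 \<le> u \<and> u < int b" for u
    using m by (auto simp: o'_def downs_def)
  have neq: "e u \<noteq> o' v" "o' u = o' v \<longleftrightarrow> u = v" "e u = e v \<longleftrightarrow> u = v" for u v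
    by (auto simp: e_def o'_def)
  have even_row: "h (e u) = e u \<or> h (e u) = e (u + 1)" if "0 \<le> u" "u < int b" for u
    using nbr[of "e u"] base[of "u - m"] that e_ups[of u] by (auto simp: e_def algebra_simps)
  have odd_row: "h (o' u) = o' u \<or> h (o' u) = o' (u + 1) \<or> h (o' u) = e (u + 1)"
    if "- 1 \<le> u" "u < int b" for u
    using nbr[of "o' u"] that o_ups[of u] by (auto simp: e_def o'_def algebra_simps)
  have "\<exists>K\<in>{0..int b}. \<forall>u\<in>{0..<int b}. h (e u) = e (u + 1) \<longleftrightarrow> K \<le> u"
  proof (rule monotone_threshold)
    fix u assume u: "0 \<le> u" "u + 1 < int b" "h (e u) = e (u + 1)"
    then show "h (e (u + 1)) = e (u + 1 + 1)"
      using even_row[of "u + 1"] inj[of "e u" "e (u + 1)"] by (auto simp: e_ups neq)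
  qed
  then obtain K where K: "0 \<le> K" "K \<le> int b"
    and thr: "\<And>u. 0 \<le> u \<Longrightarrow> u < int b \<Longrightarrow> h (e u) = e (u + 1) \<longleftrightarrow> K \<le> u"
    by auto
  have even: "h (e u) = (if u < K then e u else e (u + 1))" if "0 \<le> u" "u < int b" for u
    using thr[OF that] even_row[OF that] by auto
  have cross: "u = K - 1" if "- 1 \<le> u" "u < int b" "h (o' u) = e (u + 1)" for u
  proof (rule ccontr)
    assume "u \<noteq> K - 1"
    then consider "u + 1 < K" | "K \<le> u" by linarith
    then show False
    proof cases
      case 1
      then have "h (e (u + 1)) = h (o' u)"
        using even[of "u + 1"] that K by auto
      then show False
        using inj[of "e (u + 1)" "o' u"] 1 that K by (auto simp: e_ups o_ups neq)
    next
      case 2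
      then have "h (e u) = h (o' u)"
        using even[of u] that K by auto
      then show False
        using inj[of "e u" "o' u"] 2 that K by (auto simp: e_ups o_ups neq)
    qed
  qed
  have left: "h (o' u) = o' (u + 1)" if "- 1 \<le> u" "u < K - 1" for u
    using that
  proof (induction u rule: int_ge_induct)
    case base
    then show ?case
      using odd_row[of "-1"] cross[of "-1"] down[of "o' (-1)"] K by (auto simp: o_ups o_downs)
  next
    case (step u)
    then show ?case
      using odd_row[of "u + 1"] cross[of "u + 1"] inj[of "o' u" "o' (u + 1)"] K
      by (auto simp: o_ups neq)
  qed
  have right: "h (o' u) = o' u" if "u \<le> int b - 1" "K - 1 < u" for u
    using that
  proof (induction u rule: int_le_induct)
    case base
    then show ?case
      using odd_row[of "int b - 1"] cross[of "int b - 1"] down[of "o' (int b - 1)"] K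
      by (auto simp: o_ups o_downs)
  next
    case (step u)
    then show ?case
      using odd_row[of "u - 1"] cross[of "u - 1"] inj[of "o' u" "o' (u - 1)"] K
      by (auto simp: o_ups neq)
  qed
  have mid: "h (o' (K - 1)) = e K" if "K - 1 < int b"
  proof -
    have "h (o' (K - 1)) \<noteq> o' (K - 1)"
    proof
      assume *: "h (o' (K - 1)) = o' (K - 1)"
      then have "0 < K" using down[of "o' (K - 1)"] K by (auto simp: o_ups o_downs)
      then show False
        using left[of "K - 2"] inj[of "o' (K - 2)" "o' (K - 1)"] * K by (auto simp: o_ups neq)
    qed
    moreover have "h (o' (K - 1)) \<noteq> o' K"
    proof
      assume *: "h (o' (K - 1)) = o' K"
      then have "K < int b" using down[of "o' (K - 1)"] K by (auto simp: o_ups o_downs)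
      then show False
        using right[of K] inj[of "o' K" "o' (K - 1)"] * K by (auto simp: o_ups neq)
    qed
    ultimately show ?thesis
      using odd_row[of "K - 1"] K by auto
  qed
  have "h p = row_matching K p" if p: "p \<in> ups a b" "snd p div 2 = m" for p
  proof -
    have "snd p = 2 * m \<or> snd p = 2 * m + 1"
      using p(2) by presburger
    then have "p = e (fst p + m) \<or> p = o' (fst p + m)"
      by (cases p) (auto simp: e_def o'_def)
    then obtain u where "p = e u \<or> p = o' u" by blast
    then show ?thesis
    proof
      assume pu: "p = e u"
      then have "h p = (if u < K then e u else e (u + 1))"
        using even p(1) by (auto simp: e_ups)
      also have "\<dots> = row_matching K p"
        unfolding pu by (simp add: e_def)
      finally show ?thesis .
    next
      assume pu: "p = o' u"
      then have "h p = (if u < K - 1 then o' (u + 1) else if u = K - 1 then e (u + 1) else o' u)"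
        using left right mid p(1) by (auto simp: o_ups)
      also have "\<dots> = row_matching K p"
        unfolding pu by (simp add: e_def o'_def)
      finally show ?thesis .
    qed
  qed
  then show ?thesis using K by auto
qed

text \<open>Induction from bottom to top: as the hexagon below follows a threshold matching, all its downward
triangles are taken by its own upward triangles.\<close>

lemma matching_rows:
  assumes h: "h \<in> matchings (ups a b) (downs a b)" and m: "0 \<le> m" "m < int a"
  shows "\<exists>K\<in>{0..int b}. \<forall>p\<in>ups a b. snd p div 2 = m \<longrightarrow> h p = row_matching K p"
  using m
proof (induction m rule: int_ge_induct)
  case base
  have "h (x, 0) \<noteq> (x + 1, - 1)" if "(x, 0) \<in> ups a b" for x
  proof -
    have "h (x, 0) \<in> downs a b"
      using h that by (auto simp: matchings_def bij_betw_def)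
    then show ?thesis by (auto simp: downs_def)
  qed
  then show ?case using matching_row[OF h, of 0] base by simp
next
  case (step m)
  then obtain K where K: "0 \<le> K" "K \<le> int b"
    and row: "\<And>p. p \<in> ups a b \<Longrightarrow> snd p div 2 = m \<Longrightarrow> h p = row_matching K p"
    by force
  have "h (x, 2 * (m + 1)) \<noteq> (x + 1, 2 * (m + 1) - 1)" if x: "(x, 2 * (m + 1)) \<in> ups a b" for x
  proof
    assume eq: "h (x, 2 * (m + 1)) = (x + 1, 2 * (m + 1) - 1)"
    let ?q = "(x + 1, 2 * (m + 1) - 1)"
    have q: "?q \<in> downs a b"
      using h x eq by (force simp: matchings_def bij_betw_def)
    define p where "p = row_matching_inv K ?q"
    have p: "p \<in> ups a b" "snd p div 2 = m"
      unfolding p_def using row_matching_inv_in_ups[OF K q] row_matching_row(2)[of K ?q] by auto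
    then have "h p = h (x, 2 * (m + 1))"
      unfolding eq using row by (simp add: p_def row_matching_inverses del: row_matching.simps row_matching_inv.simps)
    then have "p = (x, 2 * (m + 1))"
      using h p x by (auto simp: matchings_def bij_betw_def inj_on_def)
    then show False using p(2) by auto
  qed
  then show ?case using matching_row[OF h, of "m + 1"] step by simp
qed

text \<open>A matching amounts to a free choice of a threshold in \<open>{0..b}\<close> for each of the
\<open>a\<close> hexagons.\<close>

lemma card_matchings: "card (matchings (ups a b) (downs a b)) = (b + 1) ^ a"
proof -
  let ?k = "{0..<int a} \<rightarrow>\<^sub>E {0..int b}"
  let ?f = "\<lambda>k. restrict (stack_matching k) (ups a b)"
  have "matchings (ups a b) (downs a b) = ?f ` ?k"
  proof
    show "?f ` ?k \<subseteq> matchings (ups a b) (downs a b)"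
    proof (rule image_subsetI)
      fix k assume "k \<in> ?k"
      then have "bij_betw (stack_matching k) (ups a b) (downs a b)"
        by (intro bij_stack_matching) (auto simp: PiE_iff)
      then show "?f k \<in> matchings (ups a b) (downs a b)"
        using row_matching_nbrs
        by (auto simp: matchings_def stack_matching_def cong: bij_betw_cong
            simp del: row_matching.simps nbrs.simps)
    qed
    show "matchings (ups a b) (downs a b) \<subseteq> ?f ` ?k"
    proof
      fix h assume h: "h \<in> matchings (ups a b) (downs a b)"
      have "\<forall>m\<in>{0..<int a}. \<exists>K. K \<in> {0..int b} \<and>
          (\<forall>p\<in>ups a b. snd p div 2 = m \<longrightarrow> h p = row_matching K p)"
        using matching_rows[OF h] by fastforce
      from bchoice[OF this] obtain k where k: "\<forall>m\<in>{0..<int a}. k m \<in> {0..int b} \<and>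
          (\<forall>p\<in>ups a b. snd p div 2 = m \<longrightarrow> h p = row_matching (k m) p)"
        by blast
      define k' where "k' = restrict k {0..<int a}"
      have "h = ?f k'"
      proof (rule extensionalityI[of h "ups a b"])
        show "h \<in> extensional (ups a b)" using h by (simp add: matchings_def)
        fix p assume p: "p \<in> ups a b"
        with row_in_range(1)[OF p] k show "h p = ?f k' p"
          by (simp add: stack_matching_def k'_def)
      qed simp
      moreover have "k' \<in> ?k" using k by (auto simp: k'_def)
      ultimately show "h \<in> ?f ` ?k" by blast
    qed
  qed
  moreover have "inj_on ?f ?k"
  proof (rule inj_onI)
    fix k k' assume k: "k \<in> ?k" "k' \<in> ?k" and "?f k = ?f k'"
    then have "stack_matching k p = stack_matching k' p" if "p \<in> ups a b" for p
      using that by (metis restrict_apply')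
    then show "k = k'"
      using stack_matching_eqD[OF k] by blast
  qed
  moreover have "card {0..int b} = b + 1"
    by simp
  ultimately show ?thesis
    by (simp add: card_image card_PiE del: card_atLeastAtMost_int)
qed

theorem proposition1p8:
  fixes a b :: nat
  assumes "0 < a" and "0 < b"
  shows "num_lozenge_tilings (hexagon_o a b a) = (b + 1) ^ a"
  unfolding hexagon_o_eq[OF assms] num_lozenge_tilings_region card_matchings ..

end
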